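(* Any $2$-dimensional quadratic Jacobi Novikov-Poisson algebra over $\mathbb{C}$ is isomorphic to one of the following $(A=\mathbb{C}e_1\oplus\mathbb{C}e_2,\cdot,\circ,\mathcal{B}(\cdot,\cdot))$, described by $\mathcal{A}=(e_i\cdot e_j)_{i,j}$, $\mathcal{N}=(e_i\circ e_j)_{i,j}$ and the metric matrix $G=(\mathcal{B}(e_i,e_j))_{i,j}$ (all parameters in $\mathbb{C}$): (1) $\mathcal{A}=\begin{pmatrix} e_1&e_2\\ e_2&0\end{pmatrix}$, $\mathcal{N}=0$, $G=\begin{pmatrix} g_{11}&g_{12}\\ g_{12}&0\end{pmatrix}$ with $g_{12}\neq 0$; (2) $\mathcal{A}=\begin{pmatrix} e_1&e_2\\ e_2&0\end{pmatrix}$, $\mathcal{N}=\begin{pmatrix} k_1e_1&-2k_1e_2\\ k_1e_2&0\end{pmatrix}$ with $k_1\neq 0$, $G=\begin{pmatrix} 0&g_{12}\\ g_{12}&0\end{pmatrix}$ with $g_{12}\neq0$; (3) $\mathcal{A}=\begin{pmatrix} e_1&e_2\\ e_2&0\end{pmatrix}$, $\mathcal{N}=\begin{pmatrix} k_1e_1+e_2&-2k_1e_2\\ k_1e_2&0\end{pmatrix}$ with $k_1\neq 0$, $G=\begin{pmatrix} -\frac{g_{12}}{k_1}&g_{12}\\ g_{12}&0\end{pmatrix}$ with $g_{12}\neq0$; (4) $\mathcal{A}=\begin{pmatrix} e_1&e_2\\ e_2&e_2\end{pmatrix}$, $\mathcal{N}=0$, $G=\begin{pmatrix} g_{11}&g_{12}\\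 g_{12}&g_{12}\end{pmatrix}$ with $g_{12}\neq0$, $g_{11}\neq g_{12}$.
   Context: Binary operations are bilinear. A Novikov algebra $(A,\circ)$ is a vector space with a binary operation satisfying $(a\circ b)\circ c-a\circ(b\circ c)=(b\circ a)\circ c-b\circ(a\circ c)$ and $(a\circ b)\circ c=(a\circ c)\circ b$. A Jacobi Novikov-Poisson algebra is a triple $(A,\cdot,\circ)$ where $(A,\cdot)$ is a unital commutative associative algebra with identity $1_A$, $(A,\circ)$ is a Novikov algebra, and $(a\cdot b)\circ c=a\cdot(b\circ c)$, $c\circ(a\cdot b)=(c\circ a)\cdot b+a\cdot(c\circ b)-a\cdot b\cdot(c\circ 1_A)$ for all $a,b,c\in A$. A quadratic Jacobi Novikov-Poisson algebra is $(A,\cdot,\circ,\mathcal{B}(\cdot,\cdot))$ with $(A,\cdot,\circ)$ a Jacobi Novikov-Poisson algebra and $\mathcal{B}$ a nondegenerate symmetric bilinear form with $\mathcal{B}(a\cdot b,c)=\mathcal{B}(a,b\cdot c)$ and $\mathcal{B}(a\circ b,c)=-\mathcal{B}(b,a\circ c+c\circ a)$ for all $a,b,c\in A$. An isomorphism of quadratic Jacobi Novikov-Poisson algebras is a bijective linear map that is a homomorphism for both $\cdot$ (preserving the identity) and $\circ$ and that carries one bilinear form to the other. *)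

theory Defs
  imports "HOL-Analysis.Analysis"
begin

definition bilinear_over ::
  "('k::field \<Rightarrow> 'a::ab_group_add \<Rightarrow> 'a) \<Rightarrow> ('k \<Rightarrow> 'b::ab_group_add \<Rightarrow> 'b) \<Rightarrow> ('a \<Rightarrow> 'a \<Rightarrow> 'b) \<Rightarrow> bool"
  where "bilinear_over s t f \<longleftrightarrow>
    (\<forall>x. Vector_Spaces.linear s t (\<lambda>y. f x y)) \<and> (\<forall>y. Vector_Spaces.linear s t (\<lambda>x. f x y))"

locale novikov_algebra = vector_space s
  for s :: "'k::field \<Rightarrow> 'a::ab_group_add \<Rightarrow> 'a" +
  fixes circ :: "'a \<Rightarrow> 'a \<Rightarrow> 'a"
  assumes circ_bilinear: "bilinear_over s s circ"
    and left_symmetric: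
      "circ (circ a b) c - circ a (circ b c) = circ (circ b a) c - circ b (circ a c)"
    and right_commutative: "circ (circ a b) c = circ (circ a c) b"

locale unital_comm_assoc_algebra = vector_space s
  for s :: "'k::field \<Rightarrow> 'a::ab_group_add \<Rightarrow> 'a" +
  fixes mul :: "'a \<Rightarrow> 'a \<Rightarrow> 'a" and one :: 'a
  assumes mul_bilinear: "bilinear_over s s mul"
    and mul_assoc: "mul (mul a b) c = mul a (mul b c)"
    and mul_commute: "mul a b = mul b a"
    and mul_one: "mul one a = a"

locale jacobi_novikov_poisson_algebra =
  unital_comm_assoc_algebra s mul one + novikov_algebra s circ
  for s :: "'k::field \<Rightarrow> 'a::ab_group_add \<Rightarrow> 'a"
    and mul :: "'a \<Rightarrow> 'a \<Rightarrow> 'a" and one :: 'a and circ :: "'a \<Rightarrow> 'a \<Rightarrow> 'a" +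
  assumes mul_circ: "circ (mul a b) c = mul a (circ b c)"
    and circ_mul:
      "circ c (mul a b) = mul (circ c a) b + mul a (circ c b) - mul (mul a b) (circ c one)"

locale quadratic_jacobi_novikov_poisson_algebra =
  jacobi_novikov_poisson_algebra s mul one circ
  for s :: "'k::field \<Rightarrow> 'a::ab_group_add \<Rightarrow> 'a"
    and mul :: "'a \<Rightarrow> 'a \<Rightarrow> 'a" and one :: 'a and circ :: "'a \<Rightarrow> 'a \<Rightarrow> 'a" +
  fixes B :: "'a \<Rightarrow> 'a \<Rightarrow> 'k"
  assumes form_bilinear: "bilinear_over s (*) B"
    and form_symmetric: "B a b = B b a"
    and form_nondegenerate: "(\<And>b. B a b = 0) \<Longrightarrow> a = 0"
    and form_mul: "B (mul a b) c = B a (mul b c)"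
    and form_circ: "B (circ a b) c = - B b (circ a c + circ c a)"

text \<open>Both sides of an isomorphism are required to be quadratic Jacobi Novikov-Poisson algebras.\<close>

locale quadratic_jnp_isomorphism =
  A: quadratic_jacobi_novikov_poisson_algebra s1 mul1 one1 circ1 B1 +
  A': quadratic_jacobi_novikov_poisson_algebra s2 mul2 one2 circ2 B2
  for s1 :: "'k::field \<Rightarrow> 'a::ab_group_add \<Rightarrow> 'a" and mul1 one1 circ1 B1
    and s2 :: "'k \<Rightarrow> 'b::ab_group_add \<Rightarrow> 'b" and mul2 one2 circ2 B2 +
  fixes f :: "'a \<Rightarrow> 'b"
  assumes linear_map: "Vector_Spaces.linear s1 s2 f"
    and bijective: "bij f"
    and map_mul: "f (mul1 x y) = mul2 (f x) (f y)"
    and map_one: "f one1 = one2"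
    and map_circ: "f (circ1 x y) = circ2 (f x) (f y)"
    and map_form: "B2 (f x) (f y) = B1 x y"

text \<open>A table \<open>T\<close> of vectors prescribes the values \<open>T $ i $ j\<close> of a bilinear operation on the
  pairs of standard basis vectors.\<close>

definition table_op :: "'k::field ^ 'n ^ 'n ^ 'n \<Rightarrow> 'k ^ 'n \<Rightarrow> 'k ^ 'n \<Rightarrow> 'k ^ 'n"
  where "table_op T x y = (\<Sum>i\<in>UNIV. \<Sum>j\<in>UNIV. (x $ i * y $ j) *s (T $ i $ j))"

definition matrix_form :: "'k::field ^ 'n ^ 'n \<Rightarrow> 'k ^ 'n \<Rightarrow> 'k ^ 'n \<Rightarrow> 'k"
  where "matrix_form G x y = (\<Sum>i\<in>UNIV. \<Sum>j\<in>UNIV. x $ i * y $ j * G $ i $ j)"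

lemma table_op_axis: "table_op T (axis i 1) (axis j 1) = T $ i $ j"
proof -
  have entry: "(axis i 1 $ i' * axis j 1 $ j') *s (T $ i' $ j')
      = (if i' = i then if j' = j then T $ i $ j else 0 else 0)" for i' j'
    by (simp add: axis_def)
  have "(\<Sum>j'\<in>UNIV. (axis i 1 $ i' * axis j 1 $ j') *s (T $ i' $ j'))
      = (if i' = i then T $ i $ j else 0)" for i'
    unfolding entry by (cases "i' = i") simp_all
  then show ?thesis by (simp add: table_op_def)
qed

lemma matrix_form_axis: "matrix_form G (axis i 1) (axis j 1) = G $ i $ j"
proof -
  have entry: "axis i 1 $ i' * axis j 1 $ j' * G $ i' $ j'
      = (if i' = i then if j' = j then G $ i $ j else 0 else 0)" for i' j'
    by (simp add: axis_def)
  have "(\<Sum>j'\<in>UNIV. axis i 1 $ i' * axis j 1 $ j' * G $ i' $ j')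
      = (if i' = i then G $ i $ j else 0)" for i'
    unfolding entry by (cases "i' = i") simp_all
  then show ?thesis by (simp add: matrix_form_def)
qed

abbreviation e\<^sub>1 :: "complex ^ 2" where "e\<^sub>1 \<equiv> axis 1 1"
abbreviation e\<^sub>2 :: "complex ^ 2" where "e\<^sub>2 \<equiv> axis 2 1"

definition mat22 :: "'b::zero \<Rightarrow> 'b \<Rightarrow> 'b \<Rightarrow> 'b \<Rightarrow> 'b ^ 2 ^ 2"
  where "mat22 a b c d = vector [vector [a, b], vector [c, d]]"

lemma mat22_nth [simp]:
  "mat22 a b c d $ 1 $ 1 = a" "mat22 a b c d $ 1 $ 2 = b"
  "mat22 a b c d $ 2 $ 1 = c" "mat22 a b c d $ 2 $ 2 = d"
  by (simp_all add: mat22_def)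

text \<open>In every multiplication table of the classification the first basis vector is the
  identity, so it is taken as the identity of the model on \<open>complex ^ 2\<close>.\<close>

definition isomorphic_to_model ::
  "(complex \<Rightarrow> 'a::ab_group_add \<Rightarrow> 'a) \<Rightarrow> ('a \<Rightarrow> 'a \<Rightarrow> 'a) \<Rightarrow> 'a \<Rightarrow> ('a \<Rightarrow> 'a \<Rightarrow> 'a)
    \<Rightarrow> ('a \<Rightarrow> 'a \<Rightarrow> complex) \<Rightarrow> complex ^ 2 ^ 2 ^ 2 \<Rightarrow> complex ^ 2 ^ 2 ^ 2 \<Rightarrow> complex ^ 2 ^ 2 \<Rightarrow> bool"
  where "isomorphic_to_model s mul one circ B \<A> \<N> G \<longleftrightarrow>
    (\<exists>f. quadratic_jnp_isomorphism s mul one circ B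
           (*s) (table_op \<A>) e\<^sub>1 (table_op \<N>) (matrix_form G) f)"

end

theory Submission
  imports Defs
begin

text \<open>
  Writing \<open>D b\<close> for \<open>one \<circ> b\<close>, compatibility of the two products gives \<open>a \<circ> b = a \<cdot> D b\<close>, so
  \<open>\<circ>\<close> is encoded in the single linear map \<open>D\<close>; and \<open>b \<mapsto> D b - b \<cdot> D one\<close> is a derivation of the
  commutative algebra. In dimension two over the complex numbers, completing the square gives a
  basis \<open>one, u\<close> with \<open>u\<^sup>2 = u\<close> or \<open>u\<^sup>2 = 0\<close>.

  A derivation kills every idempotent, so for \<open>u\<^sup>2 = u\<close> it vanishes and \<open>D\<close> is multiplication by
  \<open>D one\<close>. Invariance of the form then reads \<open>B (D b) c = - 2 * B (D b) c\<close>, and nondegeneracy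
  gives \<open>D = 0\<close>.

  For \<open>u\<^sup>2 = 0\<close> the derivation must send \<open>u\<close> to a multiple of \<open>u\<close>, while \<open>B u u = 0\<close> and
  \<open>B one u \<noteq> 0\<close>. If \<open>D one = k one + l u\<close>, then
  invariance of the form, tested on the pairs \<open>(one, u)\<close> and \<open>(one, one)\<close>, says exactly that
  \<open>D u = - 2 k u\<close> and \<open>k * B one one + l * B one u = 0\<close>. The three nilpotent models correspond to
  \<open>k = 0\<close> (which forces \<open>l = 0\<close>), to \<open>k \<noteq> 0 = l\<close>, and to \<open>k, l \<noteq> 0\<close>, where \<open>u\<close> is rescaled so
  that \<open>l = 1\<close>.

  In each case the coordinate map of the adapted basis is the isomorphism. The axioms of the
  model need no separate verification, because they are transported along it.
\<close>

section \<open>Transport of structure along a linear bijection\<close>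

lemma bilinear_over_iff:
  "bilinear_over s t f \<longleftrightarrow> vector_space s \<and> vector_space t \<and>
    (\<forall>x y z. f (x + y) z = f x z + f y z) \<and> (\<forall>c x y. f (s c x) y = t c (f x y)) \<and>
    (\<forall>x y z. f x (y + z) = f x y + f x z) \<and> (\<forall>c x y. f x (s c y) = t c (f x y))"
  unfolding bilinear_over_def Vector_Spaces.linear_iff by blast

text \<open>The map is taken from the model to the given algebra, the direction in which coordinate
  maps are given by a formula; the isomorphism is its inverse. Each axiom holds on the model since
  \<open>g\<close> is injective and turns it into the same axiom on the given algebra.\<close>

lemma isomorphism_from_transport:
  fixes s1 :: "'k::field \<Rightarrow> 'a::ab_group_add \<Rightarrow> 'a" and s2 :: "'k \<Rightarrow> 'b::ab_group_add \<Rightarrow> 'b"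
  assumes Q: "quadratic_jacobi_novikov_poisson_algebra s1 mul1 one1 circ1 B1"
    and lin: "Vector_Spaces.linear s2 s1 g" and bij: "bij g"
    and gm: "\<And>x y. g (mul2 x y) = mul1 (g x) (g y)"
    and g1: "g one2 = one1"
    and gc: "\<And>x y. g (circ2 x y) = circ1 (g x) (g y)"
    and gB: "\<And>x y. B2 x y = B1 (g x) (g y)"
  shows "quadratic_jnp_isomorphism s1 mul1 one1 circ1 B1 s2 mul2 one2 circ2 B2 (inv g)"
proof -
  interpret A: quadratic_jacobi_novikov_poisson_algebra s1 mul1 one1 circ1 B1 by (fact Q)
  have vs: "vector_space s1" "vector_space s2"
    and ga: "\<And>x y. g (x + y) = g x + g y" and gs: "\<And>c x. g (s2 c x) = s1 c (g x)"
    using lin unfolding Vector_Spaces.linear_iff by blast+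
  interpret V: vector_space s2 by (fact vs(2))
  have gd: "g (x - y) = g x - g y" for x y
    using ga[of "x - y" y] by (simp add: algebra_simps)
  have inj: "g x = g y \<longleftrightarrow> x = y" for x y
    using bij by (simp add: bij_def inj_eq)
  have giv [simp]: "g (inv g x) = x" for x
    using bij by (simp add: bij_def surj_f_inv_f)
  have inv_eq: "inv g x = y \<longleftrightarrow> x = g y" for x y
    using inj[of "inv g x" y] by simp
  have g0: "g 0 = 0" using ga[of 0 0] by simp
  note pull_back = inj[symmetric] ga gd gs gm gc gB g1
  have bm: "bilinear_over s2 s2 mul2" and bc: "bilinear_over s2 s2 circ2"
    and bB: "bilinear_over s2 (*) B2"
    using A.mul_bilinear A.circ_bilinear A.form_bilinear
    unfolding bilinear_over_iff by (simp_all add: pull_back vs)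
  have model: "quadratic_jacobi_novikov_poisson_algebra s2 mul2 one2 circ2 B2"
  proof unfold_locales
    fix a b c
    show "bilinear_over s2 s2 mul2" by (fact bm)
    show "bilinear_over s2 s2 circ2" by (fact bc)
    show "bilinear_over s2 (*) B2" by (fact bB)
    show "mul2 (mul2 a b) c = mul2 a (mul2 b c)" by (simp add: pull_back A.mul_assoc)
    show "mul2 a b = mul2 b a" by (simp add: pull_back A.mul_commute)
    show "mul2 one2 a = a" by (simp add: pull_back A.mul_one)
    show "circ2 (circ2 a b) c - circ2 a (circ2 b c) = circ2 (circ2 b a) c - circ2 b (circ2 a c)"
      unfolding pull_back by (fact A.left_symmetric)
    show "circ2 (circ2 a b) c = circ2 (circ2 a c) b"
      unfolding pull_back by (fact A.right_commutative)
    show "circ2 (mul2 a b) c = mul2 a (circ2 b c)"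
      unfolding pull_back by (fact A.mul_circ)
    show "circ2 c (mul2 a b)
        = mul2 (circ2 c a) b + mul2 a (circ2 c b) - mul2 (mul2 a b) (circ2 c one2)"
      unfolding pull_back by (fact A.circ_mul)
    show "B2 a b = B2 b a" unfolding pull_back by (fact A.form_symmetric)
    show "a = 0" if "\<And>b. B2 a b = 0"
    proof -
      have "B1 (g a) y = 0" for y using that[of "inv g y"] by (simp add: gB)
      then have "g a = 0" by (rule A.form_nondegenerate)
      then show ?thesis using inj[of a 0] g0 by simp
    qed
    show "B2 (mul2 a b) c = B2 a (mul2 b c)" unfolding pull_back by (fact A.form_mul)
    show "B2 (circ2 a b) c = - B2 b (circ2 a c + circ2 c a)"
      unfolding pull_back by (fact A.form_circ)
  qed
  show ?thesis
    unfolding quadratic_jnp_isomorphism_def quadratic_jnp_isomorphism_axioms_def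
    using Q model bij_imp_bij_inv[OF bij]
    by (simp add: Vector_Spaces.linear_iff vs inv_eq ga gs gm g1 gc gB)
qed

section \<open>Operations given by tables\<close>

lemma bilinear_over_coordinates:
  assumes lin: "Vector_Spaces.linear (*s) s g" and bil: "bilinear_over s t f"
  shows "f (g x) (g y)
    = (\<Sum>i\<in>UNIV. \<Sum>j\<in>UNIV. t (x $ i * y $ j) (f (g (axis i 1)) (g (axis j 1))))"
proof -
  interpret g: Vector_Spaces.linear "(*s)" s g by (fact lin)
  interpret t: vector_space t using bil by (simp add: bilinear_over_iff)
  interpret left: Vector_Spaces.linear s t "\<lambda>a. f a b" for b
    using bil by (simp add: bilinear_over_def)
  interpret right: Vector_Spaces.linear s t "f a" for a
    using bil by (simp add: bilinear_over_def)
  have expand: "g x = (\<Sum>i\<in>UNIV. s (x $ i) (g (axis i 1)))" for x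
    by (subst basis_expansion[symmetric]) (simp only: g.sum g.scale)
  have "f (g x) (g y) = (\<Sum>i\<in>UNIV. t (x $ i) (f (g (axis i 1)) (g y)))"
    by (subst expand[of x]) (simp only: left.sum left.scale)
  moreover have "f a (g y) = (\<Sum>j\<in>UNIV. t (y $ j) (f a (g (axis j 1))))" for a
    by (subst expand[of y]) (simp only: right.sum right.scale)
  ultimately show ?thesis
    by (simp only: t.scale_sum_right t.scale_scale)
qed

lemma linear_image_table_op:
  assumes lin: "Vector_Spaces.linear (*s) s g" and bil: "bilinear_over s s f"
    and T: "\<And>i j. g (T $ i $ j) = f (g (axis i 1)) (g (axis j 1))"
  shows "g (table_op T x y) = f (g x) (g y)"
proof -
  interpret g: Vector_Spaces.linear "(*s)" s g by (fact lin)
  show ?thesis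
    by (subst bilinear_over_coordinates[OF lin bil]) (simp add: table_op_def g.sum g.scale T)
qed

lemma matrix_form_eq_pullback:
  assumes lin: "Vector_Spaces.linear (*s) s g" and bil: "bilinear_over s (*) B"
    and G: "\<And>i j. G $ i $ j = B (g (axis i 1)) (g (axis j 1))"
  shows "matrix_form G x y = B (g x) (g y)"
  by (subst bilinear_over_coordinates[OF lin bil]) (simp add: matrix_form_def G)

section \<open>Bases with two elements\<close>

definition basis_pair :: "('k::field \<Rightarrow> 'a::ab_group_add \<Rightarrow> 'a) \<Rightarrow> 'a \<Rightarrow> 'a \<Rightarrow> bool"
  where "basis_pair s u v \<longleftrightarrow>
    (\<forall>a. \<exists>p q. a = s p u + s q v) \<and> (\<forall>p q. s p u + s q v = 0 \<longrightarrow> p = 0 \<and> q = 0)"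

context vector_space
begin

lemma basis_pair_expansion:
  assumes "basis_pair scale u v"
  obtains p q where "a = scale p u + scale q v"
  using assms unfolding basis_pair_def by blast

lemma basis_pair_eq_iff:
  assumes "basis_pair scale u v"
  shows "scale p u + scale q v = scale p' u + scale q' v \<longleftrightarrow> p = p' \<and> q = q'"
proof
  assume "scale p u + scale q v = scale p' u + scale q' v"
  then have "scale (p - p') u + scale (q - q') v = 0"
    by (simp add: scale_left_diff_distrib algebra_simps)
  then have "p - p' = 0 \<and> q - q' = 0" using assms unfolding basis_pair_def by blast
  then show "p = p' \<and> q = q'" by simp
qed simp

lemma basis_pair_right_nonzero: "basis_pair scale u v \<Longrightarrow> v \<noteq> 0"
  using basis_pair_eq_iff[of u v 0 1 0 0] by auto

lemma basis_pair_change_right: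
  assumes uv: "basis_pair scale u v" and b: "b \<noteq> 0"
  shows "basis_pair scale u (scale a u + scale b v)"
  unfolding basis_pair_def
proof (intro conjI allI impI)
  fix x
  obtain p q where x: "x = scale p u + scale q v" using uv by (rule basis_pair_expansion)
  have "x = scale (p - q / b * a) u + scale (q / b) (scale a u + scale b v)"
    using b by (simp add: x scale_right_distrib scale_left_diff_distrib)
  then show "\<exists>p q. x = scale p u + scale q (scale a u + scale b v)" by blast
next
  fix p q
  assume "scale p u + scale q (scale a u + scale b v) = 0"
  then have "scale (p + q * a) u + scale (q * b) v = scale 0 u + scale 0 v"
    by (simp add: scale_right_distrib scale_left_distrib add.assoc)
  then have "p + q * a = 0" "q * b = 0" unfolding basis_pair_eq_iff[OF uv] by auto
  then show "p = 0" "q = 0" using b by auto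
qed

lemma basis_pair_extending:
  assumes dim: "dim (UNIV :: 'b set) = 2" and u: "u \<noteq> 0"
  obtains v where "basis_pair scale u v"
proof -
  have "independent {u}" using u by (simp add: independent_insert)
  then obtain S where S: "{u} \<subseteq> S" "independent S" "UNIV \<subseteq> span S"
    by (metis maximal_independent_subset_extend subset_UNIV)
  have "card S = 2" using S dim dim_unique[of S UNIV "card S"] by simp
  then obtain v where v: "S = {u, v}" "u \<noteq> v"
    using S(1) by (auto simp: card_2_iff)
  have "\<exists>p q. a = scale p u + scale q v" for a
  proof -
    have "a \<in> span {u, v}" using S v by auto
    then obtain p q where "a - scale p u - scale q v = 0"
      by (auto simp: span_breakdown_eq)
    then have "a = scale p u + scale q v" by (simp add: algebra_simps)
    then show ?thesis by blast
  qed
  moreover have "p = 0 \<and> q = 0" if "scale p u + scale q v = 0" for p q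
  proof -
    have nv: "u \<notin> span {v}" and v0: "v \<noteq> 0"
      using S(2) v by (auto simp: independent_insert)
    have "p = 0"
    proof (rule ccontr)
      assume p: "p \<noteq> 0"
      have "scale p u = scale (- q) v"
        using that by (simp add: eq_neg_iff_add_eq_0)
      then have "scale (1 / p) (scale p u) = scale (1 / p) (scale (- q) v)" by simp
      then have "u = scale (1 / p * (- q)) v" using p by simp
      then show False using nv by (metis span_base span_scale singletonI)
    qed
    then show ?thesis using that v0 by simp
  qed
  ultimately have "basis_pair scale u v" unfolding basis_pair_def by blast
  then show thesis by (rule that)
qed

end

lemma basis_pair_coordinates:
  fixes s :: "'k::field \<Rightarrow> 'a::ab_group_add \<Rightarrow> 'a"
  defines "g \<equiv> \<lambda>u v (w :: 'k ^ 2). s (w $ 1) u + s (w $ 2) v"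
  assumes s: "vector_space s" and uv: "basis_pair s u v"
  shows "Vector_Spaces.linear (*s) s (g u v)" and "bij (g u v)"
proof -
  interpret vector_space s by (fact s)
  show "Vector_Spaces.linear (*s) s (g u v)"
    unfolding Vector_Spaces.linear_iff g_def
    by (auto simp: vector_space_axioms vec.vector_space_axioms scale_left_distrib
        scale_right_distrib algebra_simps)
  have "inj (g u v)"
    by (auto simp: inj_def g_def basis_pair_eq_iff[OF uv] vec_eq_iff forall_2)
  moreover have "surj (g u v)"
  proof -
    have "x \<in> range (g u v)" for x
    proof -
      obtain p q where "x = s p u + s q v" using uv by (rule basis_pair_expansion)
      then have "x = g u v (vector [p, q])" by (simp add: g_def)
      then show ?thesis by blast
    qed
    then show ?thesis by blast
  qed
  ultimately show "bij (g u v)" by (simp add: bij_def)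
qed

section \<open>The map \<open>b \<mapsto> one \<circ> b\<close>\<close>

context quadratic_jacobi_novikov_poisson_algebra
begin

lemma mul_linear:
  "mul (a + b) c = mul a c + mul b c" "mul a (b + c) = mul a b + mul a c"
  "mul (s k a) b = s k (mul a b)" "mul a (s k b) = s k (mul a b)"
  using mul_bilinear unfolding bilinear_over_iff by blast+

lemma circ_linear:
  "circ (a + b) c = circ a c + circ b c" "circ a (b + c) = circ a b + circ a c"
  "circ (s k a) b = s k (circ a b)" "circ a (s k b) = s k (circ a b)"
  using circ_bilinear unfolding bilinear_over_iff by blast+

lemma form_linear:
  "B (a + b) c = B a c + B b c" "B a (b + c) = B a b + B a c"
  "B (s k a) b = k * B a b" "B a (s k b) = k * B a b"
  using form_bilinear unfolding bilinear_over_iff by blast+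

lemma mul_one_right: "mul a one = a"
  by (simp add: mul_commute[of a] mul_one)

lemma zero_products [simp]:
  "mul 0 a = 0" "mul a 0 = 0" "circ 0 a = 0" "circ a 0 = 0" "B 0 a = 0" "B a 0 = 0"
  using mul_linear(3)[of 0 0 a] mul_linear(4)[of a 0 0] circ_linear(3)[of 0 0 a]
    circ_linear(4)[of a 0 0] form_linear(3)[of 0 0 a] form_linear(4)[of a 0 0] by simp_all

lemma circ_conv_one_circ: "circ a b = mul a (circ one b)"
  using mul_circ[of a one b] by (simp add: mul_one_right)

lemma one_circ_mul:
  "circ one (mul a b) = mul (circ one a) b + mul a (circ one b) - mul (mul a b) (circ one one)"
  by (fact circ_mul)

lemma form_one_circ: "B (circ one a) b = - B a (circ one b + mul b (circ one one))"
  using form_circ[of one a b] by (simp add: circ_conv_one_circ[of b one])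

lemma mul_in_one_span:
  "mul (s p one + s q u) (s p' one + s q' u)
    = s (p * p') one + s (p * q' + q * p') u + s (q * q') (mul u u)"
  by (simp add: mul_linear mul_one mul_one_right scale_right_distrib scale_left_distrib
      add_ac mult_ac)

lemma zero_if_eq_minus_double:
  fixes x :: "'f::field"
  assumes "(3 :: 'f) \<noteq> 0" and "x = - (x + x)"
  shows "x = 0"
proof -
  have "3 * x = x + (x + x)" by simp
  also have "\<dots> = 0" using assms(2) by (simp only: eq_neg_iff_add_eq_0)
  finally show ?thesis using assms(1) by simp
qed

text \<open>If the whole product is multiplication by a fixed element, both terms on the right of the
  invariance condition equal its left-hand side up to sign, so \<open>3 * B (a \<cdot> D one) b = 0\<close>.\<close>

lemma circ_zero_if_one_circ_multiplication:
  assumes three: "(3 :: 'k) \<noteq> 0" and D: "\<And>a. circ one a = mul a (circ one one)"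
  shows "circ a b = 0"
proof -
  have "B (circ one x) y = 0" for x y
  proof -
    have "B (circ one x) y = B x (circ one y)"
      by (metis D form_mul mul_commute)
    moreover have "B (circ one x) y = - (B x (circ one y) + B x (circ one y))"
      using form_one_circ[of x y] by (simp add: D[of y, symmetric] form_linear)
    ultimately show ?thesis by (metis zero_if_eq_minus_double[OF three])
  qed
  then have "circ one b = 0" by (rule form_nondegenerate)
  then show ?thesis by (simp add: circ_conv_one_circ[of a b])
qed

lemma one_nonzero:
  assumes "(a :: 'a) \<noteq> 0"
  shows "one \<noteq> 0"
  using assms mul_one[of a] by auto

lemma form_radical_basis_pair:
  assumes uv: "basis_pair s one v" and "B a one = 0" "B a v = 0"
  shows "a = 0"
proof (rule form_nondegenerate)
  fix b
  obtain p q where "b = s p one + s q v" using uv by (rule basis_pair_expansion)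
  then show "B a b = 0" using assms by (simp add: form_linear)
qed

section \<open>The idempotent case\<close>

text \<open>From \<open>u = u\<^sup>2\<close> a derivation \<open>\<delta>\<close> satisfies \<open>\<delta> u = 2 u \<cdot> \<delta> u\<close>, hence
  \<open>u \<cdot> \<delta> u = 2 u \<cdot> \<delta> u\<close>, hence \<open>\<delta> u = 0\<close>; here \<open>\<delta> b = D b - b \<cdot> D one\<close>.\<close>

lemma one_circ_idempotent:
  assumes u: "mul u u = u"
  shows "circ one u = mul u (circ one one)"
proof -
  let ?x = "circ one u" and ?d = "circ one one"
  have x: "?x = mul u ?x + mul u ?x - mul u ?d"
    using one_circ_mul[of u u] by (simp add: u mul_commute[of ?x u])
  have uu: "mul u (mul u y) = mul u y" for y
    by (simp add: mul_assoc[symmetric] u)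
  have "mul u ?x + mul u ?d = mul u (?x + mul u ?d)" by (simp add: mul_linear uu)
  also have "?x + mul u ?d = mul u ?x + mul u ?x" using x by (simp add: algebra_simps)
  also have "mul u (mul u ?x + mul u ?x) = mul u ?x + mul u ?x"
    by (simp add: mul_linear uu)
  finally have "mul u ?d = mul u ?x" by simp
  with x show ?thesis by simp
qed

lemma circ_zero_if_idempotent_basis:
  assumes three: "(3 :: 'k) \<noteq> 0" and uv: "basis_pair s one u" and u: "mul u u = u"
  shows "circ a b = 0"
proof (rule circ_zero_if_one_circ_multiplication[OF three])
  fix x
  obtain p q where x: "x = s p one + s q u" using uv by (rule basis_pair_expansion)
  show "circ one x = mul x (circ one one)"
    by (simp add: x circ_linear mul_linear mul_one one_circ_idempotent[OF u])
qed

lemma form_idempotent_basis: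
  assumes uv: "basis_pair s one u" and u: "mul u u = u"
  shows "B u u = B one u" and "B one u \<noteq> 0" and "B one one \<noteq> B one u"
proof -
  show uu: "B u u = B one u" using form_mul[of one u u] by (simp add: mul_one u)
  show "B one u \<noteq> 0"
  proof
    assume "B one u = 0"
    then have "u = 0"
      using uu by (intro form_radical_basis_pair[OF uv]) (simp_all add: form_symmetric[of u one])
    then show False using basis_pair_right_nonzero[OF uv] by simp
  qed
  show "B one one \<noteq> B one u"
  proof
    assume eq: "B one one = B one u"
    \<comment> \<open>The complementary idempotent \<open>one - u\<close> would be orthogonal to everything.\<close>
    have "s 1 one + s (- 1) u = 0"
      using uu eq
      by (intro form_radical_basis_pair[OF uv])
        (simp_all only: form_linear form_symmetric[of u one], simp_all)
    then show False using uv unfolding basis_pair_def by fastforce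
  qed
qed

section \<open>The square-zero case\<close>

lemma form_square_zero_basis:
  assumes uv: "basis_pair s one u" and u: "mul u u = 0"
  shows "B u u = 0" and "B one u \<noteq> 0"
proof -
  show uu: "B u u = 0" using form_mul[of one u u] by (simp add: mul_one u)
  show "B one u \<noteq> 0"
  proof
    assume "B one u = 0"
    then have "u = 0"
      using uu by (intro form_radical_basis_pair[OF uv]) (simp_all add: form_symmetric[of u one])
    then show False using basis_pair_right_nonzero[OF uv] by simp
  qed
qed

text \<open>The Leibniz rule for \<open>u\<^sup>2 = 0\<close> reads \<open>2 u \<cdot> D u = 0\<close>, so \<open>D u\<close> has no component along the
  identity. Its coefficient at \<open>u\<close> comes from the form on \<open>(one, u)\<close>, and the relation between
  \<open>k\<close> and \<open>l\<close> from the form on \<open>(one, one)\<close>.\<close>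

lemma one_circ_square_zero:
  assumes two: "(2 :: 'k) \<noteq> 0" and three: "(3 :: 'k) \<noteq> 0"
    and uv: "basis_pair s one u" and u: "mul u u = 0"
    and d: "circ one one = s k one + s l u"
  shows "circ one u = s (- 2 * k) u" and "k * B one one + l * B one u = 0"
proof -
  note form = form_square_zero_basis[OF uv u]
  obtain q p where x: "circ one u = s q one + s p u" using uv by (rule basis_pair_expansion)
  have "s 0 one + s (2 * q) u = s 0 one + s 0 u"
    using one_circ_mul[of u u]
    by (simp add: u x mul_linear mul_one mul_one_right scale_left_distrib[symmetric])
  then have q: "q = 0" unfolding basis_pair_eq_iff[OF uv] using two by simp
  have "B (circ one one) u = - B one (circ one u + mul u (circ one one))"
    by (fact form_one_circ)
  then have "k * B one u = - ((p + k) * B one u)"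
    by (simp add: d x q mul_linear mul_one_right u form_linear form algebra_simps)
  then have "(p + 2 * k) * B one u = 0" by (simp add: algebra_simps)
  then have "p = - 2 * k" using form by (simp add: eq_neg_iff_add_eq_0)
  then show "circ one u = s (- 2 * k) u" using x q by simp
  have "B (circ one one) one = - (B one (circ one one) + B one (circ one one))"
    using form_one_circ[of one one] by (simp add: mul_one form_linear)
  then have "B one (circ one one) = 0"
    unfolding form_symmetric[of "circ one one" one] by (rule zero_if_eq_minus_double[OF three])
  then show "k * B one one + l * B one u = 0" by (simp add: d form_linear)
qed

end

section \<open>The adapted basis and the isomorphism\<close>

text \<open>Completing the square turns \<open>v\<^sup>2 = p one + q v\<close> into \<open>w\<^sup>2 = r one\<close> with \<open>w = v - (q / 2) one\<close>.
  If \<open>r \<noteq> 0\<close> has square root \<open>t\<close>, then \<open>(one + w / t) / 2\<close> is idempotent.\<close>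

lemma (in quadratic_jacobi_novikov_poisson_algebra) adapted_basis:
  assumes sqrt: "\<And>r :: 'k. \<exists>t. t * t = r" and two: "(2 :: 'k) \<noteq> 0"
    and dim: "dim (UNIV :: 'a set) = 2"
  obtains u where "basis_pair s one u" "mul u u = 0 \<or> mul u u = u"
proof -
  have "one \<noteq> 0"
  proof
    assume "one = 0"
    then have "(UNIV :: 'a set) = {0}" using one_nonzero by auto
    then have "dim (UNIV :: 'a set) \<le> card ({} :: 'a set)"
      by (intro dim_le_card) auto
    then show False using dim by simp
  qed
  with dim obtain v where v: "basis_pair s one v" by (rule basis_pair_extending)
  obtain p q where sq: "mul v v = s p one + s q v" using v by (rule basis_pair_expansion)
  define r where "r = p + (q / 2) * (q / 2)"
  define w where "w = s (- (q / 2)) one + s 1 v"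
  have w: "basis_pair s one w" unfolding w_def by (rule basis_pair_change_right[OF v]) simp
  have "mul w w = s ((q / 2) * (q / 2)) one + s (- q) v + mul v v"
    unfolding w_def mul_in_one_span using two by (simp add: field_simps)
  also have "\<dots> = s r one"
    by (simp add: sq r_def scale_left_distrib)
  finally have ww: "mul w w = s r one" .
  show thesis
  proof (cases "r = 0")
    case True
    then show ?thesis using w ww by (intro that[of w]) simp_all
  next
    case False
    obtain t where t: "t * t = r" using sqrt by blast
    with False have t0: "t \<noteq> 0" by auto
    define u where "u = s (1 / 2) one + s (1 / (2 * t)) w"
    have u: "basis_pair s one u" unfolding u_def
      by (rule basis_pair_change_right[OF w]) (simp add: t0 two)
    have "(4 :: 'k) = 2 * 2" by simp
    then have four: "(4 :: 'k) \<noteq> 0" using two by (metis mult_eq_0_iff)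
    have quarter: "1 / (2 * t) * (1 / (2 * t)) * r = 1 / 2 * (1 / 2)"
      using t0 two four by (simp add: t[symmetric] field_simps)
    have half: "1 / 2 * (1 / 2) + 1 / 2 * (1 / 2) = (1 / 2 :: 'k)"
      using two four by (simp add: field_simps)
    have cross: "1 / 2 * (1 / (2 * t)) + 1 / (2 * t) * (1 / 2) = 1 / (2 * t)"
      using two four t0 by (simp add: field_simps)
    have "mul u u = s (1 / 2 * (1 / 2) + 1 / 2 * (1 / 2)) one + s (1 / (2 * t)) w"
      unfolding u_def mul_in_one_span cross ww scale_scale quarter scale_left_distrib
      by (simp only: add_ac)
    then have "mul u u = u" unfolding half u_def .
    then show ?thesis using u by (intro that[of u]) simp_all
  qed
qed

text \<open>To recognise a model it suffices to compare the tables on the basis \<open>one, u\<close>, and in the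
  multiplication table only the entry \<open>u\<^sup>2\<close> is at stake, because \<open>one\<close> is the identity.\<close>

lemma isomorphic_to_model_if_tables:
  fixes s :: "complex \<Rightarrow> 'a::ab_group_add \<Rightarrow> 'a"
  assumes Q: "quadratic_jacobi_novikov_poisson_algebra s mul one circ B"
    and uv: "basis_pair s one u"
  defines "g \<equiv> \<lambda>w :: complex ^ 2. s (w $ 1) one + s (w $ 2) u"
  assumes A: "g a = mul u u"
    and N: "g n\<^sub>1\<^sub>1 = circ one one" "g n\<^sub>1\<^sub>2 = circ one u"
      "g n\<^sub>2\<^sub>1 = circ u one" "g n\<^sub>2\<^sub>2 = circ u u"
  shows "isomorphic_to_model s mul one circ B (mat22 e\<^sub>1 e\<^sub>2 e\<^sub>2 a) (mat22 n\<^sub>1\<^sub>1 n\<^sub>1\<^sub>2 n\<^sub>2\<^sub>1 n\<^sub>2\<^sub>2)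
    (mat22 (B one one) (B one u) (B one u) (B u u))"
proof -
  interpret quadratic_jacobi_novikov_poisson_algebra s mul one circ B by (fact Q)
  have lin: "Vector_Spaces.linear (*s) s g" and bij: "bij g"
    unfolding g_def by (rule basis_pair_coordinates[OF vector_space_axioms uv])+
  have e: "g e\<^sub>1 = one" "g e\<^sub>2 = u" by (simp_all add: g_def axis_def)
  have "\<forall>i j. g (mat22 e\<^sub>1 e\<^sub>2 e\<^sub>2 a $ i $ j) = mul (g (axis i 1)) (g (axis j 1))"
    unfolding forall_2 by (simp add: e A mul_one mul_one_right)
  note mul_table = linear_image_table_op[OF lin mul_bilinear this[rule_format]]
  have "\<forall>i j. g (mat22 n\<^sub>1\<^sub>1 n\<^sub>1\<^sub>2 n\<^sub>2\<^sub>1 n\<^sub>2\<^sub>2 $ i $ j) = circ (g (axis i 1)) (g (axis j 1))"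
    unfolding forall_2 by (simp add: e N)
  note circ_table = linear_image_table_op[OF lin circ_bilinear this[rule_format]]
  have "\<forall>i j. mat22 (B one one) (B one u) (B one u) (B u u) $ i $ j
      = B (g (axis i 1)) (g (axis j 1))"
    unfolding forall_2 by (simp add: e form_symmetric[of u one])
  note form_table = matrix_form_eq_pullback[OF lin form_bilinear this[rule_format]]
  show ?thesis
    unfolding isomorphic_to_model_def
    by (rule exI[of _ "inv g"], rule isomorphism_from_transport[OF Q lin bij])
      (fact mul_table e(1) circ_table form_table)+
qed

text \<open>The coefficient \<open>l\<close> is left free so that one statement serves all three nilpotent models: it is
  \<open>0\<close> in the first two and \<open>1\<close> in the third.\<close>

lemma isomorphic_to_square_zero_model:
  fixes s :: "complex \<Rightarrow> 'a::ab_group_add \<Rightarrow> 'a"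
  assumes Q: "quadratic_jacobi_novikov_poisson_algebra s mul one circ B"
    and uv: "basis_pair s one u" and u: "mul u u = 0"
    and d: "circ one one = s k one + s l u"
  shows "isomorphic_to_model s mul one circ B (mat22 e\<^sub>1 e\<^sub>2 e\<^sub>2 0)
    (mat22 (k *s e\<^sub>1 + l *s e\<^sub>2) ((- 2 * k) *s e\<^sub>2) (k *s e\<^sub>2) 0)
    (mat22 (B one one) (B one u) (B one u) 0)"
proof -
  interpret quadratic_jacobi_novikov_poisson_algebra s mul one circ B by (fact Q)
  have x: "circ one u = s (- 2 * k) u"
    using one_circ_square_zero(1)[OF _ _ uv u d] by simp
  have "circ u one = s k u" "circ u u = 0"
    using circ_conv_one_circ[of u one] circ_conv_one_circ[of u u]
    by (simp_all add: d x mul_linear mul_one_right u del: scale_minus_left)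
  then have "isomorphic_to_model s mul one circ B (mat22 e\<^sub>1 e\<^sub>2 e\<^sub>2 0)
      (mat22 (k *s e\<^sub>1 + l *s e\<^sub>2) ((- 2 * k) *s e\<^sub>2) (k *s e\<^sub>2) 0)
      (mat22 (B one one) (B one u) (B one u) (B u u))"
    by (intro isomorphic_to_model_if_tables[OF Q uv]) (simp_all add: axis_def u d x)
  then show ?thesis by (simp add: form_square_zero_basis(1)[OF uv u])
qed

lemma mat22_zero: "mat22 0 0 0 0 = 0"
  by (simp add: vec_eq_iff forall_2)

theorem proposition3p11:
  fixes s :: "complex \<Rightarrow> 'a::ab_group_add \<Rightarrow> 'a"
    and mul circ :: "'a \<Rightarrow> 'a \<Rightarrow> 'a" and one :: 'a
    and B :: "'a \<Rightarrow> 'a \<Rightarrow> complex"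
  assumes "quadratic_jacobi_novikov_poisson_algebra s mul one circ B"
    and "vector_space.dim s (UNIV :: 'a set) = 2"
  shows
    "(\<exists>g\<^sub>1\<^sub>1 g\<^sub>1\<^sub>2. g\<^sub>1\<^sub>2 \<noteq> 0 \<and>
        isomorphic_to_model s mul one circ B
          (mat22 e\<^sub>1 e\<^sub>2
                 e\<^sub>2 0)
          0
          (mat22 g\<^sub>1\<^sub>1 g\<^sub>1\<^sub>2
                 g\<^sub>1\<^sub>2 0)) \<or>
     (\<exists>k\<^sub>1 g\<^sub>1\<^sub>2. k\<^sub>1 \<noteq> 0 \<and> g\<^sub>1\<^sub>2 \<noteq> 0 \<and>
        isomorphic_to_model s mul one circ B
          (mat22 e\<^sub>1 e\<^sub>2
                 e\<^sub>2 0)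
          (mat22 (k\<^sub>1 *s e\<^sub>1) ((- 2 * k\<^sub>1) *s e\<^sub>2)
                 (k\<^sub>1 *s e\<^sub>2) 0)
          (mat22 0 g\<^sub>1\<^sub>2
                 g\<^sub>1\<^sub>2 0)) \<or>
     (\<exists>k\<^sub>1 g\<^sub>1\<^sub>2. k\<^sub>1 \<noteq> 0 \<and> g\<^sub>1\<^sub>2 \<noteq> 0 \<and>
        isomorphic_to_model s mul one circ B
          (mat22 e\<^sub>1 e\<^sub>2
                 e\<^sub>2 0)
          (mat22 (k\<^sub>1 *s e\<^sub>1 + e\<^sub>2) ((- 2 * k\<^sub>1) *s e\<^sub>2)
                 (k\<^sub>1 *s e\<^sub>2) 0)
          (mat22 (- (g\<^sub>1\<^sub>2 / k\<^sub>1)) g\<^sub>1\<^sub>2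
                 g\<^sub>1\<^sub>2 0)) \<or>
     (\<exists>g\<^sub>1\<^sub>1 g\<^sub>1\<^sub>2. g\<^sub>1\<^sub>2 \<noteq> 0 \<and> g\<^sub>1\<^sub>1 \<noteq> g\<^sub>1\<^sub>2 \<and>
        isomorphic_to_model s mul one circ B
          (mat22 e\<^sub>1 e\<^sub>2
                 e\<^sub>2 e\<^sub>2)
          0
          (mat22 g\<^sub>1\<^sub>1 g\<^sub>1\<^sub>2
                 g\<^sub>1\<^sub>2 g\<^sub>1\<^sub>2))"
proof -
  interpret quadratic_jacobi_novikov_poisson_algebra s mul one circ B by (fact assms(1))
  have sqrt: "\<exists>t. t * t = r" for r :: complex
    by (metis power2_csqrt power2_eq_square)
  obtain u where u: "basis_pair s one u" and sq: "mul u u = 0 \<or> mul u u = u"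
    using adapted_basis[OF sqrt _ assms(2)] by auto
  from sq show ?thesis
  proof
    assume u2: "mul u u = u"
    have "isomorphic_to_model s mul one circ B (mat22 e\<^sub>1 e\<^sub>2 e\<^sub>2 e\<^sub>2) (mat22 0 0 0 0)
        (mat22 (B one one) (B one u) (B one u) (B u u))"
      using circ_zero_if_idempotent_basis[OF _ u u2]
      by (intro isomorphic_to_model_if_tables[OF assms(1) u]) (simp_all add: axis_def u2)
    then show ?thesis
      unfolding mat22_zero using form_idempotent_basis[OF u u2] by metis
  next
    assume u2: "mul u u = 0"
    note form = form_square_zero_basis[OF u u2]
    obtain k l where d: "circ one one = s k one + s l u"
      using u by (rule basis_pair_expansion)
    have rel: "k * B one one + l * B one u = 0"
      using one_circ_square_zero(2)[OF _ _ u u2 d] by simp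
    note model = isomorphic_to_square_zero_model[OF assms(1) u u2 d]
    consider "k = 0" | "k \<noteq> 0" "l = 0" | "k \<noteq> 0" "l \<noteq> 0" by blast
    then show ?thesis
    proof cases
      case 1
      then have "l = 0" using rel form by simp
      then show ?thesis using model form 1 by (auto simp: mat22_zero)
    next
      case 2
      then have "B one one = 0" using rel by simp
      then have "isomorphic_to_model s mul one circ B (mat22 e\<^sub>1 e\<^sub>2 e\<^sub>2 0)
          (mat22 (k *s e\<^sub>1) ((- 2 * k) *s e\<^sub>2) (k *s e\<^sub>2) 0)
          (mat22 0 (B one u) (B one u) 0)"
        using model 2 by simp
      then show ?thesis using 2 form by blast
    next
      case 3
      define v where "v = s l u"
      have v: "basis_pair s one v"
        using basis_pair_change_right[OF u 3(2), of 0] by (simp add: v_def)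
      have v2: "mul v v = 0" by (simp add: v_def mul_linear u2)
      have dv: "circ one one = s k one + s 1 v" by (simp add: d v_def)
      have "k * B one one = - B one v"
        using rel by (simp add: v_def form_linear eq_neg_iff_add_eq_0)
      then have "B one one = - (B one v / k)"
        using 3 by (simp add: field_simps)
      then have "isomorphic_to_model s mul one circ B (mat22 e\<^sub>1 e\<^sub>2 e\<^sub>2 0)
          (mat22 (k *s e\<^sub>1 + e\<^sub>2) ((- 2 * k) *s e\<^sub>2) (k *s e\<^sub>2) 0)
          (mat22 (- (B one v / k)) (B one v) (B one v) 0)"
        using isomorphic_to_square_zero_model[OF assms(1) v v2 dv] by simp
      then show ?thesis using 3 form_square_zero_basis(2)[OF v v2] by blast
    qed
  qed
qed

end
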